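(* Let $\mathcal{G}=(B,\psi,A)$ be a $d$-regular real quantum graph. Then the spectral radius $r(A)$ of the adjacency matrix $A$ (as a linear operator on $B$) satisfies $r(A)=d$.
   Context: A quantum set is a pair $(B,\psi)$ where $B$ is a finite-dimensional $C^*$-algebra with multiplication $m:B\otimes B\to B$, and $\psi$ is a faithful state on $B$ that is a $\delta$-form, i.e. $mm^\dagger=\delta^2\,\mathrm{id}_B$ for some $\delta\ge 0$. Here $B$ is regarded as the Hilbert space $L^2(B,\psi)$ with inner product $\langle x|y\rangle=\psi(x^*y)$, $B\otimes B$ carries the inner product from $\psi\otimes\psi$, and $(\cdot)^\dagger$ is the Hilbert space adjoint of operators. For linear maps $S,T:B\to B$, the Schur product is $S\bullet T=\delta^{-2}m(S\otimes T)m^\dagger$ and the involution is $T^*(x)=(T(x^* ))^*$. A quantum graph is a triple $(B,\psi,A)$ with $(B,\psi)$ a quantum set and $A:B\to B$ linear (the adjacency matrix) satisfying $A\bullet A=A$. It is real if $A^*=A$. It is $d$-regular ($d\in\mathbb{C}$) if $A1_B=d1_B=A^\dagger 1_B$. *)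

theory Defs
  imports "HOL-Analysis.Analysis"
begin

section \<open>Complex vector spaces and \<open>C\<^sup>*\<close>-algebras\<close>

class scaleC =
  fixes scaleC :: "complex \<Rightarrow> 'a \<Rightarrow> 'a" (infixr "*\<^sub>C" 75)

class complex_vector = scaleC + ab_group_add +
  assumes scaleC_add_right: "c *\<^sub>C (x + y) = c *\<^sub>C x + c *\<^sub>C y"
    and scaleC_add_left: "(c + d) *\<^sub>C x = c *\<^sub>C x + d *\<^sub>C x"
    and scaleC_scaleC: "c *\<^sub>C (d *\<^sub>C x) = (c * d) *\<^sub>C x"
    and scaleC_one: "1 *\<^sub>C x = x"

global_interpretation complex_vector:
  vector_space "scaleC :: complex \<Rightarrow> 'a \<Rightarrow> 'a::complex_vector"
  by unfold_locales (simp_all add: scaleC_add_right scaleC_add_left scaleC_scaleC scaleC_one)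

abbreviation clinear :: "('a::complex_vector \<Rightarrow> 'b::complex_vector) \<Rightarrow> bool" where
  "clinear \<equiv> Vector_Spaces.linear scaleC scaleC"

instantiation complex :: complex_vector
begin
definition scaleC_complex :: "complex \<Rightarrow> complex \<Rightarrow> complex" where
  "scaleC_complex c x = c * x"
instance by standard (simp_all add: scaleC_complex_def algebra_simps)
end

text \<open>No unit is required here, so that the class also covers the tensor product below
  without a proof that \<open>1 \<otimes> 1 \<noteq> 0\<close>.\<close>

class star_algebra = complex_vector + ring +
  fixes star :: "'a \<Rightarrow> 'a"
  assumes mult_scaleC_left: "(c *\<^sub>C x) * y = c *\<^sub>C (x * y)"
    and mult_scaleC_right: "x * (c *\<^sub>C y) = c *\<^sub>C (x * y)"
    and star_star: "star (star x) = x"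
    and star_add: "star (x + y) = star x + star y"
    and star_scaleC: "star (c *\<^sub>C x) = cnj c *\<^sub>C star x"
    and star_mult: "star (x * y) = star y * star x"

text \<open>Nonzero unital \<open>C\<^sup>*\<close>-algebras. Finite-dimensional \<open>C\<^sup>*\<close>-algebras are automatically
  unital, and the zero algebra carries no state, so neither condition is a restriction for
  quantum sets.\<close>

class unital_cstar_algebra = star_algebra + real_normed_algebra_1 + complete_space +
  assumes scaleR_scaleC: "r *\<^sub>R x = complex_of_real r *\<^sub>C x"
    and norm_scaleC: "norm (c *\<^sub>C x) = cmod c * norm x"
    and norm_star_mult_self: "norm (star x * x) = (norm x)\<^sup>2"

instantiation complex :: unital_cstar_algebra
begin
definition star_complex :: "complex \<Rightarrow> complex" where
  "star_complex = cnj"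
instance
  by standard (simp_all add: scaleC_complex_def star_complex_def scaleR_conv_of_real norm_mult
      power2_eq_square algebra_simps)
end


section \<open>The algebraic tensor product\<close>

text \<open>A list \<open>[(x\<^sub>1, y\<^sub>1), \<dots>, (x\<^sub>n, y\<^sub>n)]\<close> stands for \<open>x\<^sub>1 \<otimes> y\<^sub>1 + \<dots> + x\<^sub>n \<otimes> y\<^sub>n\<close>. Scalars can
  be absorbed into the first factor, so lists suffice to write all formal combinations of
  pairs. \<open>tensor_eq\<close> is the least additive congruence containing the bilinearity relations.\<close>

inductive tensor_eq ::
  "('a::complex_vector \<times> 'b::complex_vector) list \<Rightarrow> ('a \<times> 'b) list \<Rightarrow> bool" where
  refl: "tensor_eq xs xs"
| sym: "tensor_eq xs ys \<Longrightarrow> tensor_eq ys xs"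
| trans: "tensor_eq xs ys \<Longrightarrow> tensor_eq ys zs \<Longrightarrow> tensor_eq xs zs"
| append: "tensor_eq xs xs' \<Longrightarrow> tensor_eq ys ys' \<Longrightarrow> tensor_eq (xs @ ys) (xs' @ ys')"
| commute: "tensor_eq (xs @ ys) (ys @ xs)"
| zero: "tensor_eq [(0, y)] []"
| add_left: "tensor_eq [(x + x', y)] [(x, y), (x', y)]"
| add_right: "tensor_eq [(x, y + y')] [(x, y), (x, y')]"
| scale: "tensor_eq [(c *\<^sub>C x, y)] [(x, c *\<^sub>C y)]"

quotient_type (overloaded) ('a, 'b) tensor =
    "('a::complex_vector \<times> 'b::complex_vector) list" / tensor_eq
  by (intro equivpI reflpI sympI transpI) (blast intro: tensor_eq.intros)+

lift_definition tensor :: "'a::complex_vector \<Rightarrow> 'b::complex_vector \<Rightarrow> ('a, 'b) tensor"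
    (infixr "\<otimes>" 70)
  is "\<lambda>x y. [(x, y)]" .

lemma tensor_eq_scale:
  assumes "tensor_eq xs ys"
  shows "tensor_eq (map (\<lambda>(x, y). (c *\<^sub>C x, y)) xs) (map (\<lambda>(x, y). (c *\<^sub>C x, y)) ys)"
  using assms
proof induction
  case (scale d x y)
  have "tensor_eq [(d *\<^sub>C (c *\<^sub>C x), y)] [(c *\<^sub>C x, d *\<^sub>C y)]" by (rule tensor_eq.scale)
  then show ?case by (simp add: mult.commute)
qed (auto intro: tensor_eq.intros simp: complex_vector.scale_right_distrib)

lemma tensor_eq_minus:
  "tensor_eq (map (\<lambda>(x, y). (- x, y)) xs @ xs) []"
proof (induction xs)
  case (Cons p xs)
  obtain x y where p: "p = (x, y)" by force
  have "tensor_eq [(- x + x, y)] [(- x, y), (x, y)]" by (rule tensor_eq.add_left)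
  moreover have "tensor_eq [(- x + x, y)] []" by (simp add: tensor_eq.zero)
  ultimately have 1: "tensor_eq [(- x, y), (x, y)] []"
    by (blast intro: tensor_eq.sym tensor_eq.trans)
  let ?m = "map (\<lambda>(x, y). (- x, y)) xs"
  have "tensor_eq ((?m @ [(x, y)]) @ xs) (([(x, y)] @ ?m) @ xs)"
    by (rule tensor_eq.append[OF tensor_eq.commute tensor_eq.refl])
  then have "tensor_eq ([(- x, y)] @ (?m @ [(x, y)]) @ xs) ([(- x, y)] @ ([(x, y)] @ ?m) @ xs)"
    by (rule tensor_eq.append[OF tensor_eq.refl])
  also have "[(- x, y)] @ ([(x, y)] @ ?m) @ xs = [(- x, y), (x, y)] @ (?m @ xs)" by simp
  finally have "tensor_eq ([(- x, y)] @ (?m @ [(x, y)]) @ xs) ([(- x, y), (x, y)] @ (?m @ xs))" .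
  moreover have "tensor_eq ([(- x, y), (x, y)] @ (?m @ xs)) ([] @ [])"
    by (rule tensor_eq.append[OF 1 Cons.IH])
  ultimately have "tensor_eq ([(- x, y)] @ (?m @ [(x, y)]) @ xs) ([] @ [])"
    by (rule tensor_eq.trans)
  then show ?case by (simp add: p)
qed (simp add: tensor_eq.refl)

lemma tensor_eq_uminus:
  assumes "tensor_eq xs ys"
  shows "tensor_eq (map (\<lambda>(x, y). (- x, y)) xs) (map (\<lambda>(x, y). (- x, y)) ys)"
  using tensor_eq_scale[OF assms, of "-1"] by simp

instantiation tensor :: (complex_vector, complex_vector) complex_vector
begin

lift_definition zero_tensor :: "('a, 'b) tensor" is "[]" .

lift_definition plus_tensor :: "('a, 'b) tensor \<Rightarrow> ('a, 'b) tensor \<Rightarrow> ('a, 'b) tensor"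
  is "(@)" by (rule tensor_eq.append)

lift_definition uminus_tensor :: "('a, 'b) tensor \<Rightarrow> ('a, 'b) tensor"
  is "map (\<lambda>(x, y). (- x, y))" by (rule tensor_eq_uminus)

definition minus_tensor :: "('a, 'b) tensor \<Rightarrow> ('a, 'b) tensor \<Rightarrow> ('a, 'b) tensor" where
  "minus_tensor u v = u + - v"

lift_definition scaleC_tensor :: "complex \<Rightarrow> ('a, 'b) tensor \<Rightarrow> ('a, 'b) tensor"
  is "\<lambda>c. map (\<lambda>(x, y). (c *\<^sub>C x, y))" by (rule tensor_eq_scale)

instance
proof
  fix u v w :: "('a, 'b) tensor" and c d :: complex
  show "u + v + w = u + (v + w)" by transfer (simp add: tensor_eq.refl)
  show "u + v = v + u" by transfer (rule tensor_eq.commute)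
  show "0 + u = u" by transfer (simp add: tensor_eq.refl)
  show "- u + u = 0" by transfer (rule tensor_eq_minus)
  show "u - v = u + - v" by (rule minus_tensor_def)
  show "c *\<^sub>C (u + v) = c *\<^sub>C u + c *\<^sub>C v" by transfer (simp add: tensor_eq.refl)
  show "c *\<^sub>C (d *\<^sub>C u) = (c * d) *\<^sub>C u"
    by transfer (simp add: tensor_eq.refl comp_def case_prod_unfold)
  show "1 *\<^sub>C u = u" by transfer (simp add: tensor_eq.refl case_prod_unfold)
  show "(c + d) *\<^sub>C u = c *\<^sub>C u + d *\<^sub>C u"
  proof transfer
    fix c d :: complex and xs :: "('a \<times> 'b) list"
    let ?f = "\<lambda>c. map (\<lambda>(x::'a, y::'b). (c *\<^sub>C x, y))"
    show "tensor_eq (?f (c + d) xs) (?f c xs @ ?f d xs)"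
    proof (induction xs)
      case (Cons p xs)
      obtain x y where p: "p = (x, y)" by force
      have "tensor_eq [((c + d) *\<^sub>C x, y)] [(c *\<^sub>C x, y), (d *\<^sub>C x, y)]"
        unfolding complex_vector.scale_left_distrib by (rule tensor_eq.add_left)
      then have "tensor_eq ([((c + d) *\<^sub>C x, y)] @ ?f (c + d) xs)
          ([(c *\<^sub>C x, y), (d *\<^sub>C x, y)] @ (?f c xs @ ?f d xs))"
        by (rule tensor_eq.append[OF _ Cons.IH])
      moreover have "tensor_eq ([(c *\<^sub>C x, y)] @ ([(d *\<^sub>C x, y)] @ ?f c xs) @ ?f d xs)
          ([(c *\<^sub>C x, y)] @ (?f c xs @ [(d *\<^sub>C x, y)]) @ ?f d xs)"
        by (rule tensor_eq.append[OF tensor_eq.refl tensor_eq.append[OF tensor_eq.commute tensor_eq.refl]])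
      ultimately show ?case by (auto simp: p intro: tensor_eq.trans)
    qed (simp add: tensor_eq.refl)
  qed
qed

end

lemma tensor_zero_left: "0 \<otimes> y = 0"
  by transfer (rule tensor_eq.zero)

lemma tensor_add_left: "(x + x') \<otimes> y = x \<otimes> y + x' \<otimes> y"
  by transfer (simp add: tensor_eq.add_left)

lemma tensor_add_right: "x \<otimes> (y + y') = x \<otimes> y + x \<otimes> y'"
  by transfer (simp add: tensor_eq.add_right)

lemma scaleC_tensor_left: "c *\<^sub>C (x \<otimes> y) = (c *\<^sub>C x) \<otimes> y"
  by transfer (simp add: tensor_eq.refl)

lemma scaleC_tensor_right: "c *\<^sub>C (x \<otimes> y) = x \<otimes> (c *\<^sub>C y)"
  by transfer (simp add: tensor_eq.scale)

lemma tensor_induct [case_names zero tensor add]: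
  assumes "P 0" and "\<And>x y. P (x \<otimes> y)" and "\<And>u v. P u \<Longrightarrow> P v \<Longrightarrow> P (u + v)"
  shows "P t"
proof -
  have "P (abs_tensor xs)" for xs
  proof (induction xs)
    case Nil
    then show ?case using assms(1) by (simp add: zero_tensor_def)
  next
    case (Cons p xs)
    obtain x y where p: "p = (x, y)" by force
    have "abs_tensor (p # xs) = x \<otimes> y + abs_tensor xs"
      by (simp add: p tensor.abs_eq plus_tensor.abs_eq)
    then show ?case using assms(2,3) Cons.IH by metis
  qed
  then show ?thesis by (metis Quotient_tensor Quotient_abs_rep)
qed

text \<open>Biadditive maps in which scalars can be moved between the arguments descend to the tensor
  product. This covers bilinear maps, as well as the conjugate-bilinear map that induces the
  involution on a tensor product of \<open>*\<close>-algebras. \<open>tensor_lift f\<close> is meaningful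
  only for \<open>balanced f\<close>, where it does not depend on the chosen representative.\<close>

definition balanced ::
    "('a::complex_vector \<Rightarrow> 'b::complex_vector \<Rightarrow> 'c::ab_group_add) \<Rightarrow> bool" where
  "balanced f \<longleftrightarrow>
     (\<forall>x x' y. f (x + x') y = f x y + f x' y) \<and>
     (\<forall>x y y'. f x (y + y') = f x y + f x y') \<and>
     (\<forall>c x y. f (c *\<^sub>C x) y = f x (c *\<^sub>C y))"

definition tensor_lift ::
    "('a::complex_vector \<Rightarrow> 'b::complex_vector \<Rightarrow> 'c::ab_group_add) \<Rightarrow> ('a, 'b) tensor \<Rightarrow> 'c" where
  "tensor_lift f t = (\<Sum>(x, y)\<leftarrow>rep_tensor t. f x y)"

lemma tensor_lift_abs:
  assumes "balanced f"
  shows "tensor_lift f (abs_tensor xs) = (\<Sum>(x, y)\<leftarrow>xs. f x y)"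
proof -
  have zero: "f 0 y = 0" for y
    using assms unfolding balanced_def by (metis add_0_right add_left_imp_eq)
  have "(\<Sum>(x, y)\<leftarrow>xs. f x y) = (\<Sum>(x, y)\<leftarrow>ys. f x y)" if "tensor_eq xs ys" for xs ys
    using that
    by induction (use assms in \<open>auto simp: balanced_def zero add.commute\<close>)
  moreover have "tensor_eq (rep_tensor (abs_tensor xs)) xs"
    using Quotient_rep_abs[OF Quotient_tensor] tensor_eq.refl by blast
  ultimately show ?thesis unfolding tensor_lift_def by blast
qed

lemma tensor_lift_zero: "balanced f \<Longrightarrow> tensor_lift f 0 = 0"
  by (simp add: zero_tensor_def tensor_lift_abs)

lemma tensor_lift_tensor: "balanced f \<Longrightarrow> tensor_lift f (x \<otimes> y) = f x y"
  by (simp add: tensor.abs_eq tensor_lift_abs)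

lemma tensor_lift_add:
  assumes "balanced f"
  shows "tensor_lift f (u + v) = tensor_lift f u + tensor_lift f v"
proof -
  have "tensor_lift f (abs_tensor xs + abs_tensor ys)
      = tensor_lift f (abs_tensor xs) + tensor_lift f (abs_tensor ys)" for xs ys
    by (simp add: plus_tensor.abs_eq tensor_lift_abs assms)
  then show ?thesis by (metis Quotient_tensor Quotient_abs_rep)
qed

lemmas tensor_lift_simps = tensor_lift_zero tensor_lift_tensor tensor_lift_add

lemma tensor_lift_fun_add:
  "tensor_lift (\<lambda>x y. f x y + g x y) t = tensor_lift f t + tensor_lift g t"
  by (simp add: tensor_lift_def case_prod_unfold sum_list_addf)


section \<open>The tensor product of \<open>*\<close>-algebras\<close>

lemma balanced_times_inner:
  fixes a :: "'a::star_algebra" and b :: "'b::star_algebra"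
  shows "balanced (\<lambda>c d. (a * c) \<otimes> (b * d))"
  by (simp add: balanced_def distrib_left tensor_add_left tensor_add_right mult_scaleC_right
      flip: scaleC_tensor_left scaleC_tensor_right)

lemma balanced_times_outer:
  fixes v :: "('a::star_algebra, 'b::star_algebra) tensor"
  shows "balanced (\<lambda>a b. tensor_lift (\<lambda>c d. (a * c) \<otimes> (b * d)) v)"
  by (simp add: balanced_def distrib_right tensor_add_left tensor_add_right mult_scaleC_left
      tensor_lift_fun_add flip: scaleC_tensor_left scaleC_tensor_right)

lemma balanced_star:
  "balanced (\<lambda>(a::'a::star_algebra) (b::'b::star_algebra). star a \<otimes> star b)"
  by (simp add: balanced_def star_add star_scaleC tensor_add_left tensor_add_right
      flip: scaleC_tensor_left scaleC_tensor_right)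

instantiation tensor :: (star_algebra, star_algebra) star_algebra
begin

definition times_tensor :: "('a, 'b) tensor \<Rightarrow> ('a, 'b) tensor \<Rightarrow> ('a, 'b) tensor" where
  "u * v = tensor_lift (\<lambda>a b. tensor_lift (\<lambda>c d. (a * c) \<otimes> (b * d)) v) u"

definition star_tensor :: "('a, 'b) tensor \<Rightarrow> ('a, 'b) tensor" where
  "star = tensor_lift (\<lambda>a b. star a \<otimes> star b)"

instance
proof
  fix u v w :: "('a, 'b) tensor" and c :: complex
  have tt: "(a \<otimes> b) * (a' \<otimes> b') = (a * a') \<otimes> (b * b')" for a a' :: 'a and b b' :: 'b
    unfolding times_tensor_def tensor_lift_tensor[OF balanced_times_outer]
    by (rule tensor_lift_tensor[OF balanced_times_inner])
  have l: "(u + v) * w = u * w + v * w" for u v w :: "('a, 'b) tensor"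
    by (simp add: times_tensor_def tensor_lift_simps balanced_times_outer)
  have r: "u * (v + w) = u * v + u * w" for u v w :: "('a, 'b) tensor"
    by (simp add: times_tensor_def tensor_lift_simps balanced_times_inner tensor_lift_fun_add)
  have l0: "0 * v = 0" for v :: "('a, 'b) tensor"
    by (simp add: times_tensor_def tensor_lift_simps balanced_times_outer)
  have r0: "u * 0 = 0" for u :: "('a, 'b) tensor"
    using r[of u 0 0] by simp
  show "(u + v) * w = u * w + v * w" by (rule l)
  show "u * (v + w) = u * v + u * w" by (rule r)
  show "u * v * w = u * (v * w)"
  proof (induction u rule: tensor_induct)
    case (tensor a b)
    show ?case
    proof (induction v rule: tensor_induct)
      case (tensor a' b')
      show ?case
        by (induction w rule: tensor_induct) (simp_all add: tt l r l0 r0 mult.assoc)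
    qed (simp_all add: l r l0 r0)
  qed (simp_all add: l r l0 r0)
  show "(c *\<^sub>C u) * v = c *\<^sub>C (u * v)"
  proof (induction u rule: tensor_induct)
    case (tensor a b)
    show ?case
      by (induction v rule: tensor_induct)
        (simp_all add: tt l r l0 r0 scaleC_add_right scaleC_tensor_left mult_scaleC_left)
  qed (simp_all add: l r l0 r0 scaleC_add_right)
  show "u * (c *\<^sub>C v) = c *\<^sub>C (u * v)"
  proof (induction u rule: tensor_induct)
    case (tensor a b)
    show ?case
      by (induction v rule: tensor_induct)
        (simp_all add: tt l r l0 r0 scaleC_add_right scaleC_tensor_left mult_scaleC_right)
  qed (simp_all add: l r l0 r0 scaleC_add_right)
  have s0: "star (0 :: ('a, 'b) tensor) = 0"
    by (simp add: star_tensor_def tensor_lift_simps balanced_star)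
  have st: "star (a \<otimes> b) = star a \<otimes> star b" for a :: 'a and b :: 'b
    by (simp add: star_tensor_def tensor_lift_simps balanced_star)
  have sa: "star (u + v) = star u + star v" for u v :: "('a, 'b) tensor"
    by (simp add: star_tensor_def tensor_lift_simps balanced_star)
  show "star (star u) = u"
    by (induction u rule: tensor_induct) (simp_all add: s0 st sa star_star)
  show "star (u + v) = star u + star v" by (rule sa)
  show "star (c *\<^sub>C u) = cnj c *\<^sub>C star u"
    by (induction u rule: tensor_induct)
      (simp_all add: s0 st sa scaleC_add_right scaleC_tensor_left star_scaleC)
  show "star (u * v) = star v * star u"
  proof (induction u rule: tensor_induct)
    case (tensor a b)
    show ?case
      by (induction v rule: tensor_induct)
        (simp_all add: tt l r l0 r0 s0 st sa star_mult)
  qed (simp_all add: l r l0 r0 s0 sa)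
qed

end

definition tensor_functional ::
    "('a::complex_vector \<Rightarrow> complex) \<Rightarrow> ('b::complex_vector \<Rightarrow> complex) \<Rightarrow> ('a, 'b) tensor \<Rightarrow> complex"
  where "tensor_functional \<phi> \<omega> = tensor_lift (\<lambda>x y. \<phi> x * \<omega> y)"

definition tensor_map ::
    "('a::complex_vector \<Rightarrow> 'c::complex_vector) \<Rightarrow> ('b::complex_vector \<Rightarrow> 'd::complex_vector)
      \<Rightarrow> ('a, 'b) tensor \<Rightarrow> ('c, 'd) tensor"
  where "tensor_map S T = tensor_lift (\<lambda>x y. S x \<otimes> T y)"

definition mult_map :: "('a::star_algebra, 'a) tensor \<Rightarrow> 'a" where
  "mult_map = tensor_lift (*)"


section \<open>Quantum sets and quantum graphs\<close>

definition state :: "('a::unital_cstar_algebra \<Rightarrow> complex) \<Rightarrow> bool" where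
  "state \<psi> \<longleftrightarrow> clinear \<psi> \<and> (\<forall>x. \<psi> (star x * x) \<in> \<real>\<^sub>\<ge>\<^sub>0) \<and> \<psi> 1 = 1"

definition faithful :: "('a::star_algebra \<Rightarrow> complex) \<Rightarrow> bool" where
  "faithful \<psi> \<longleftrightarrow> (\<forall>x. \<psi> (star x * x) = 0 \<longrightarrow> x = 0)"

definition L2_inner :: "('a::star_algebra \<Rightarrow> complex) \<Rightarrow> 'a \<Rightarrow> 'a \<Rightarrow> complex" where
  "L2_inner \<psi> x y = \<psi> (star x * y)"

text \<open>The Hilbert space adjoint of \<open>F : L\<^sup>2(\<phi>) \<rightarrow> L\<^sup>2(\<omega>)\<close>; it exists uniquely whenever \<open>F\<close> is linear
  and \<open>\<phi>\<close>, \<open>\<omega>\<close> are faithful positive functionals on finite-dimensional algebras.\<close>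

definition dagger ::
    "('a::star_algebra \<Rightarrow> complex) \<Rightarrow> ('b::star_algebra \<Rightarrow> complex) \<Rightarrow> ('a \<Rightarrow> 'b) \<Rightarrow> ('b \<Rightarrow> 'a)" where
  "dagger \<phi> \<omega> F = (THE G. \<forall>x y. L2_inner \<omega> (F x) y = L2_inner \<phi> x (G y))"

definition mult_dagger :: "('a::star_algebra \<Rightarrow> complex) \<Rightarrow> 'a \<Rightarrow> ('a, 'a) tensor" where
  "mult_dagger \<psi> = dagger (tensor_functional \<psi> \<psi>) \<psi> mult_map"

text \<open>The parameter \<open>\<delta>\<close> is uniquely determined by \<open>\<psi>\<close>.\<close>

locale quantum_set =
  fixes \<psi> :: "'a::unital_cstar_algebra \<Rightarrow> complex" and \<delta> :: real
  assumes finite_dimensional: "\<exists>S::'a set. finite S \<and> complex_vector.span S = UNIV"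
    and state: "state \<psi>"
    and faithful: "faithful \<psi>"
    and delta_nonneg: "\<delta> \<ge> 0"
    and delta_form: "mult_map (mult_dagger \<psi> x) = complex_of_real (\<delta>\<^sup>2) *\<^sub>C x"

definition schur_product ::
    "('a::star_algebra \<Rightarrow> complex) \<Rightarrow> real \<Rightarrow> ('a \<Rightarrow> 'a) \<Rightarrow> ('a \<Rightarrow> 'a) \<Rightarrow> 'a \<Rightarrow> 'a" where
  "schur_product \<psi> \<delta> S T x =
     complex_of_real (1 / \<delta>\<^sup>2) *\<^sub>C mult_map (tensor_map S T (mult_dagger \<psi> x))"

definition star_map :: "('a::star_algebra \<Rightarrow> 'a) \<Rightarrow> 'a \<Rightarrow> 'a" where
  "star_map T x = star (T (star x))"

locale quantum_graph = quantum_set \<psi> \<delta>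
  for \<psi> :: "'a::unital_cstar_algebra \<Rightarrow> complex" and \<delta> :: real +
  fixes A :: "'a \<Rightarrow> 'a"
  assumes linear: "clinear A"
    and schur_idempotent: "schur_product \<psi> \<delta> A A = A"

definition real_map :: "('a::star_algebra \<Rightarrow> 'a) \<Rightarrow> bool" where
  "real_map A \<longleftrightarrow> star_map A = A"

definition regular ::
    "('a::unital_cstar_algebra \<Rightarrow> complex) \<Rightarrow> ('a \<Rightarrow> 'a) \<Rightarrow> complex \<Rightarrow> bool" where
  "regular \<psi> A d \<longleftrightarrow> A 1 = d *\<^sub>C 1 \<and> dagger \<psi> \<psi> A 1 = d *\<^sub>C 1"


section \<open>Spectral radius\<close>

text \<open>For a linear operator on a finite-dimensional space, invertibility is bijectivity.\<close>

definition op_spectrum :: "('a::complex_vector \<Rightarrow> 'a) \<Rightarrow> complex set" where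
  "op_spectrum T = {z. \<not> bij (\<lambda>x. T x - z *\<^sub>C x)}"

definition op_spectral_radius :: "('a::complex_vector \<Rightarrow> 'a) \<Rightarrow> real" where
  "op_spectral_radius T = Sup (cmod ` op_spectrum T)"

end

theory Submission
  imports Defs
begin

text \<open>The spectral radius is \<open>d\<close> because \<open>A\<close> has \<open>1\<close> as an eigenvector with eigenvalue \<open>d\<close>, while
  \<open>A\<close> has norm at most \<open>d\<close> on the Hilbert space \<open>L\<^sup>2(B, \<psi>)\<close>. The norm bound is an instance of the
  Kadison--Schwarz inequality for completely positive maps.

  For an orthonormal basis \<open>E\<close> of \<open>L\<^sup>2(B, \<psi>)\<close> the adjoint of the multiplication is
  \<open>m\<^sup>\<dagger>(a b) = (\<Sum>e\<in>E. a e \<otimes> e\<^sup>* b)\<close> (\<open>mult_dagger_mult\<close>). Hence a real Schur idempotent \<open>A\<close> satisfies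
  \<open>A (x\<^sup>* y) = \<delta>\<^sup>-\<^sup>2 (\<Sum>e\<in>E. A (e\<^sup>* x)\<^sup>* A (e\<^sup>* y))\<close> (\<open>adjacency_gram\<close>). This Gram representation makes complete
  positivity visible; expanding the square of \<open>A (e\<^sup>* x) - A (e\<^sup>*) c\<close> gives
  \<open>0 \<le> \<psi> (A (x\<^sup>* x) - A (x)\<^sup>* c - c\<^sup>* A (x) + c\<^sup>* A (1) c)\<close> for every \<open>c \<in> B\<close>
  (\<open>schwarz_positivity\<close>). At \<open>x = 1\<close>, \<open>c = 0\<close> this shows
  \<open>d \<ge> 0\<close>. If \<open>d > 0\<close>, then with \<open>A 1 = d 1\<close> and
  \<open>c = A x / d\<close> it becomes
  \<open>\<psi> (A (x)\<^sup>* A (x)) \<le> d \<psi> (A (x\<^sup>* x))\<close>, and the other half of regularity, \<open>A\<^sup>\<dagger> 1 = d 1\<close>, says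
  \<open>\<psi> \<circ> A = d \<psi>\<close>. Together they give \<open>\<parallel>A x\<parallel>\<^sub>2 \<le> d \<parallel>x\<parallel>\<^sub>2\<close> (\<open>L2_bound\<close>), so every spectral value, being
  an eigenvalue in finite dimension, has modulus at most \<open>d\<close>.\<close>

section \<open>Linear maps, involutions and tensors\<close>

global_interpretation complex_vector_pair:
  vector_space_pair "scaleC :: complex \<Rightarrow> 'a \<Rightarrow> 'a::complex_vector"
    "scaleC :: complex \<Rightarrow> 'b \<Rightarrow> 'b::complex_vector"
  by unfold_locales

lemma star_zero: "star 0 = (0::'a::star_algebra)"
  using star_add[of 0 "0::'a"] by simp

lemma star_minus: "star (x - y) = star x - star (y::'a::star_algebra)"
  using star_add[of "x - y" y] by simp

lemma star_sum: "star (sum f S) = (\<Sum>i\<in>S. star (f i :: 'a::star_algebra))"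
  by (induction S rule: infinite_finite_induct) (simp_all add: star_zero star_add)

lemma star_one: "star 1 = (1::'a::unital_cstar_algebra)"
  using star_mult[of "star 1" "1::'a"] by (simp add: star_star)

lemma tensor_zero_right: "x \<otimes> 0 = 0"
  using tensor_add_right[of x 0 0] by simp

lemma tensor_sum_left: "sum f S \<otimes> y = (\<Sum>i\<in>S. f i \<otimes> y)"
  by (induction S rule: infinite_finite_induct) (simp_all add: tensor_zero_left tensor_add_left)

lemma tensor_lift_sum:
  "balanced f \<Longrightarrow> tensor_lift f (sum g S) = (\<Sum>i\<in>S. tensor_lift f (g i))"
  by (induction S rule: infinite_finite_induct) (simp_all add: tensor_lift_simps)

lemma balanced_mult: "balanced ((*) :: 'a::star_algebra \<Rightarrow> 'a \<Rightarrow> 'a)"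
  by (simp add: balanced_def distrib_left distrib_right mult_scaleC_left mult_scaleC_right)

lemma balanced_tensor_map:
  assumes "clinear S" "clinear T"
  shows "balanced (\<lambda>x y. S x \<otimes> T y)"
  using assms
  by (simp add: balanced_def complex_vector_pair.linear_add complex_vector_pair.linear_scale
      tensor_add_left tensor_add_right flip: scaleC_tensor_left scaleC_tensor_right)

lemma balanced_functional:
  fixes \<phi> :: "'a::complex_vector \<Rightarrow> complex" and \<omega> :: "'b::complex_vector \<Rightarrow> complex"
  assumes "clinear \<phi>" "clinear \<omega>"
  shows "balanced (\<lambda>x y. \<phi> x * \<omega> y)"
  using assms
  by (simp add: balanced_def complex_vector_pair.linear_add complex_vector_pair.linear_scale
      scaleC_complex_def algebra_simps)

lemma mult_tensor:
  "(a \<otimes> b) * (c \<otimes> d) = (a * c) \<otimes> ((b::'b::star_algebra) * d)" for a :: "'a::star_algebra"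
  unfolding times_tensor_def tensor_lift_tensor[OF balanced_times_outer]
  by (rule tensor_lift_tensor[OF balanced_times_inner])

lemma star_tensor: "star (a \<otimes> b) = star a \<otimes> star b"
  by (simp add: star_tensor_def tensor_lift_tensor balanced_star)

text \<open>Since \<^const>\<open>dagger\<close> is a definite description, a computed adjoint has to be checked against
  every competitor; nondegeneracy of the inner product on the source excludes the others.\<close>

lemma dagger_eqI:
  assumes "\<And>x y. L2_inner \<omega> (F x) y = L2_inner \<phi> x (G y)"
    and "\<And>u v. (\<And>x. L2_inner \<phi> x u = L2_inner \<phi> x v) \<Longrightarrow> u = v"
  shows "dagger \<phi> \<omega> F = G"
  unfolding dagger_def
proof (rule the_equality)
  fix G' assume "\<forall>x y. L2_inner \<omega> (F x) y = L2_inner \<phi> x (G' y)"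
  then show "G' = G" using assms by (metis ext)
qed (use assms in blast)

section \<open>The Hilbert space of a quantum set\<close>

context quantum_set
begin

abbreviation ip :: "'a \<Rightarrow> 'a \<Rightarrow> complex" where "ip \<equiv> L2_inner \<psi>"

lemma linear_state: "clinear \<psi>"
  using state by (simp add: state_def)

lemmas state_add = complex_vector_pair.linear_add[OF linear_state]
  and state_diff = complex_vector_pair.linear_diff[OF linear_state]
  and state_sum = complex_vector_pair.linear_sum[OF linear_state]

lemma state_scale: "\<psi> (c *\<^sub>C x) = c * \<psi> x"
  using complex_vector_pair.linear_scale[OF linear_state] by (simp add: scaleC_complex_def)

lemma state_star: "\<psi> (star x) = cnj (\<psi> x)"
proof -
  have real: "Im (\<psi> (star y * y)) = 0" for y
    using state by (auto simp: state_def complex_nonneg_Reals_iff)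
  \<comment> \<open>Polarization: \<open>x + 1\<close> compares the imaginary parts and \<open>x + \<i>\<close> the real parts.\<close>
  have "Im (\<psi> x + \<psi> (star x)) = 0"
    using real[of "x + 1"] real[of x] real[of 1]
    by (simp add: star_add star_one algebra_simps state_add)
  moreover have "Im (\<i> * \<psi> (star x) - \<i> * \<psi> x) = 0"
    using real[of "x + \<i> *\<^sub>C 1"] real[of x] real[of 1]
    by (simp add: star_add star_one algebra_simps state_add state_diff star_scaleC
        mult_scaleC_left mult_scaleC_right state_scale scaleC_scaleC)
  ultimately show ?thesis by (simp add: complex_eq_iff)
qed

lemma ip_cnj: "cnj (ip x y) = ip y x"
  by (simp add: L2_inner_def star_mult star_star flip: state_star)

lemma ip_add_right: "ip x (y + z) = ip x y + ip x z"
  by (simp add: L2_inner_def distrib_left state_add)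

lemma ip_diff_right: "ip x (y - z) = ip x y - ip x z"
  by (simp add: L2_inner_def right_diff_distrib state_diff)

lemma ip_sum_right: "ip x (sum f S) = (\<Sum>i\<in>S. ip x (f i))"
  by (simp add: L2_inner_def sum_distrib_left state_sum)

lemma ip_sum_left: "ip (sum f S) y = (\<Sum>i\<in>S. ip (f i) y)"
  by (simp add: L2_inner_def sum_distrib_right state_sum star_sum)

lemma ip_scale_right: "ip x (c *\<^sub>C y) = c * ip x y"
  by (simp add: L2_inner_def mult_scaleC_right state_scale)

lemma ip_scale_left: "ip (c *\<^sub>C x) y = cnj c * ip x y"
  by (simp add: L2_inner_def mult_scaleC_left state_scale star_scaleC)

lemma ip_mult_left: "ip (a * x) y = ip x (star a * y)"
  by (simp add: L2_inner_def star_mult mult.assoc)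

lemma ip_zero_left: "ip 0 y = 0"
  using ip_scale_left[of 0 0 y] by simp

lemma ip_self_Im: "Im (ip x x) = 0"
  using ip_cnj[of x x] by (simp add: complex_eq_iff)

lemma ip_self_nonneg: "0 \<le> Re (ip x x)"
  using state by (auto simp: state_def L2_inner_def complex_nonneg_Reals_iff)

lemma ip_self_eq_0: "ip x x = 0 \<Longrightarrow> x = 0"
  using faithful by (simp add: faithful_def L2_inner_def)

lemma ip_self_pos: "x \<noteq> 0 \<Longrightarrow> 0 < Re (ip x x)"
  using ip_self_eq_0[of x] ip_self_Im[of x] ip_self_nonneg[of x]
  by (auto simp: complex_eq_iff less_le)

lemma ip_nondegenerate:
  assumes "\<And>x. ip x u = ip x v" shows "u = v"
  using ip_self_eq_0[of "u - v"] assms[of "u - v"] by (simp add: ip_diff_right)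

subsection \<open>Orthonormal bases\<close>

definition onb :: "'a set \<Rightarrow> bool" where
  "onb E \<longleftrightarrow> finite E \<and> (\<forall>e\<in>E. \<forall>f\<in>E. ip e f = (if e = f then 1 else 0))
     \<and> (\<forall>x. (\<Sum>e\<in>E. ip e x *\<^sub>C e) = x)"

text \<open>The Gram--Schmidt process. Carrying the expansion formula on \<open>S\<close> through the induction,
  instead of an equality of spans, makes the step a computation.\<close>

lemma gram_schmidt:
  assumes "finite S"
  shows "\<exists>E. finite E \<and> (\<forall>e\<in>E. \<forall>f\<in>E. ip e f = (if e = f then 1 else 0))
     \<and> (\<forall>x\<in>S. (\<Sum>e\<in>E. ip e x *\<^sub>C e) = x)"
  using assms
proof induction
  case empty
  show ?case by (rule exI[of _ "{}"]) simp
next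
  case (insert s S)
  then obtain E where E: "finite E"
      and on: "\<And>e f. e \<in> E \<Longrightarrow> f \<in> E \<Longrightarrow> ip e f = (if e = f then 1 else 0)"
      and ex: "\<And>x. x \<in> S \<Longrightarrow> (\<Sum>e\<in>E. ip e x *\<^sub>C e) = x"
    by metis
  define r where "r = s - (\<Sum>e\<in>E. ip e s *\<^sub>C e)"
  show ?case
  proof (cases "r = 0")
    case True
    then have "(\<Sum>e\<in>E. ip e s *\<^sub>C e) = s" by (simp add: r_def)
    then show ?thesis using E on ex by (intro exI[of _ E]) blast
  next
    case False
    define c where "c = complex_of_real (sqrt (Re (ip r r)))"
    define g where "g = (1 / c) *\<^sub>C r"
    have c0: "c \<noteq> 0" using ip_self_pos[OF False] by (simp add: c_def)
    have cc: "ip r r = c * c" "cnj c = c"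
      using ip_self_Im[of r] ip_self_nonneg[of r]
      by (simp_all add: c_def complex_eq_iff)
    have r: "r = c *\<^sub>C g" using c0 by (simp add: g_def scaleC_scaleC scaleC_one)
    have eg: "ip e g = 0" if "e \<in> E" for e
    proof -
      have "ip e r = ip e s - (\<Sum>f\<in>E. ip f s * (if e = f then 1 else 0))"
        using that on by (simp add: r_def ip_diff_right ip_sum_right ip_scale_right)
      also have "\<dots> = 0" using E that by (simp add: if_distrib cong: if_cong)
      finally show ?thesis by (simp add: g_def ip_scale_right)
    qed
    have ge: "ip g e = 0" if "e \<in> E" for e
      using eg[OF that] ip_cnj[of e g] by simp
    have gg: "ip g g = 1"
      using c0 by (simp add: g_def ip_scale_right ip_scale_left cc)
    have gE: "g \<notin> E" using eg gg by force
    have gx: "ip g (\<Sum>e\<in>E. ip e x *\<^sub>C e) = 0" for x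
      by (simp add: ip_sum_right ip_scale_right ge)
    have "ip g s = ip g ((\<Sum>e\<in>E. ip e s *\<^sub>C e) + r)" by (simp add: r_def)
    also have "\<dots> = c" by (subst ip_add_right) (simp add: gx, simp add: r ip_scale_right gg)
    finally have gs: "ip g s = c" .
    have "(\<Sum>e\<in>insert g E. ip e x *\<^sub>C e) = x" if "x \<in> insert s S" for x
    proof (cases "x = s")
      case True
      have "(\<Sum>e\<in>insert g E. ip e s *\<^sub>C e) = c *\<^sub>C g + (\<Sum>e\<in>E. ip e s *\<^sub>C e)"
        using E gE by (simp add: gs)
      also have "\<dots> = s" unfolding r[symmetric] by (simp add: r_def)
      finally show ?thesis using True by simp
    next
      case False
      then have x: "(\<Sum>e\<in>E. ip e x *\<^sub>C e) = x" using that ex by auto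
      then have "ip g x = 0" using gx[of x] by simp
      then show ?thesis using E gE x by simp
    qed
    moreover have "ip e f = (if e = f then 1 else 0)" if "e \<in> insert g E" "f \<in> insert g E" for e f
      using that on[of e f] eg[of e] ge[of f] gg gE by (cases "e = g"; cases "f = g") auto
    ultimately show ?thesis
      using E by (intro exI[of _ "insert g E"]) blast
  qed
qed

lemma onb_exists: "\<exists>E. onb E"
proof -
  obtain S where S: "finite S" "complex_vector.span S = (UNIV::'a set)"
    using finite_dimensional by blast
  obtain E where E: "finite E" "\<forall>e\<in>E. \<forall>f\<in>E. ip e f = (if e = f then 1 else 0)"
      "\<forall>x\<in>S. (\<Sum>e\<in>E. ip e x *\<^sub>C e) = x"
    using gram_schmidt[OF S(1)] by blast
  have "(\<Sum>e\<in>E. ip e x *\<^sub>C e) = x" if "x \<in> complex_vector.span S" for x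
    using that
  proof (induction rule: complex_vector.span_induct_alt)
    case base
    have "ip e 0 = 0" for e using ip_scale_right[of e 0 0] by simp
    then show ?case by simp
  next
    case (step c x y)
    have "(\<Sum>e\<in>E. ip e (c *\<^sub>C x + y) *\<^sub>C e)
        = c *\<^sub>C (\<Sum>e\<in>E. ip e x *\<^sub>C e) + (\<Sum>e\<in>E. ip e y *\<^sub>C e)"
      by (simp add: ip_add_right ip_scale_right scaleC_add_left sum.distrib
          complex_vector.scale_sum_right scaleC_scaleC)
    also have "\<dots> = c *\<^sub>C x + y"
      using E(3) step by simp
    finally show ?case .
  qed
  then have "onb E" using E(1,2) S(2) by (simp add: onb_def)
  then show ?thesis ..
qed

lemma onb_expand: "onb E \<Longrightarrow> (\<Sum>e\<in>E. ip e x *\<^sub>C e) = x"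
  by (simp add: onb_def)

text \<open>Existence of the adjoint: \<open>T\<^sup>\<dagger> y\<close> has the coordinates \<open>\<langle>T e, y\<rangle>\<close>.\<close>

lemma ip_dagger:
  assumes T: "clinear T"
  shows "ip (T x) y = ip x (dagger \<psi> \<psi> T y)"
proof -
  obtain E where E: "onb E" using onb_exists by blast
  have *: "ip (T x) y = ip x (\<Sum>e\<in>E. ip (T e) y *\<^sub>C e)" for x y
  proof -
    have "T (\<Sum>e\<in>E. ip e x *\<^sub>C e) = (\<Sum>e\<in>E. ip e x *\<^sub>C T e)"
      by (simp add: complex_vector_pair.linear_sum complex_vector_pair.linear_scale T)
    then have "T x = (\<Sum>e\<in>E. ip e x *\<^sub>C T e)"
      by (simp add: onb_expand[OF E])
    then show ?thesis
      by (simp add: ip_sum_left ip_sum_right ip_scale_left ip_scale_right ip_cnj mult.commute)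
  qed
  have "dagger \<psi> \<psi> T = (\<lambda>y. \<Sum>e\<in>E. ip (T e) y *\<^sub>C e)"
    by (rule dagger_eqI) (rule *, rule ip_nondegenerate)
  then show ?thesis using * by metis
qed

subsection \<open>The adjoint of the multiplication\<close>

abbreviation ip2 :: "('a, 'a) tensor \<Rightarrow> ('a, 'a) tensor \<Rightarrow> complex" where
  "ip2 \<equiv> L2_inner (tensor_functional \<psi> \<psi>)"

lemmas balanced_state = balanced_functional[OF linear_state linear_state]

lemma ip2_tensor: "ip2 (a \<otimes> b) (c \<otimes> d) = ip a c * ip b d"
  by (simp add: L2_inner_def star_tensor mult_tensor tensor_functional_def tensor_lift_tensor
      balanced_state)

lemma ip2_add_left: "ip2 (u + v) w = ip2 u w + ip2 v w"
  by (simp add: L2_inner_def star_add distrib_right tensor_functional_def tensor_lift_add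
      balanced_state)

lemma ip2_zero_left: "ip2 0 w = 0"
  using ip2_add_left[of 0 0 w] by simp

lemma ip2_sum_right: "ip2 u (sum f S) = (\<Sum>i\<in>S. ip2 u (f i))"
  by (simp add: L2_inner_def sum_distrib_left tensor_functional_def tensor_lift_sum balanced_state)

text \<open>Every tensor is \<open>\<Sum>e\<in>E. e \<otimes> w\<^sub>e\<close> with coefficients \<open>w\<^sub>e \<in> B\<close>, and pairing with \<open>e \<otimes> x\<close>
  reads off \<open>\<langle>x, w\<^sub>e\<rangle>\<close>. So nondegeneracy passes from \<open>B\<close> to \<open>B \<otimes> B\<close>.\<close>

lemma ip2_nondegenerate:
  assumes "\<And>t. ip2 t u = ip2 t v"
  shows "u = v"
proof -
  obtain E where E: "onb E" using onb_exists by blast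
  define coef where "coef e = tensor_lift (\<lambda>x y::'a. ip e x *\<^sub>C y)" for e :: 'a
  have bal: "balanced (\<lambda>x y::'a. ip e x *\<^sub>C y)" for e
    by (simp add: balanced_def ip_add_right ip_scale_right scaleC_add_left scaleC_add_right
        scaleC_scaleC mult.commute)
  have expand: "w = (\<Sum>e\<in>E. e \<otimes> coef e w)" for w
  proof (induction w rule: tensor_induct)
    case zero
    then show ?case by (simp only: coef_def tensor_lift_zero[OF bal] tensor_zero_right sum.neutral_const)
  next
    case (tensor x y)
    have "x \<otimes> y = (\<Sum>e\<in>E. ip e x *\<^sub>C e) \<otimes> y" by (simp add: onb_expand[OF E])
    also have "\<dots> = (\<Sum>e\<in>E. e \<otimes> coef e (x \<otimes> y))"
      by (simp add: tensor_sum_left coef_def tensor_lift_tensor[OF bal]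
          flip: scaleC_tensor_left scaleC_tensor_right)
    finally show ?case .
  next
    case (add w w')
    have "coef e (w + w') = coef e w + coef e w'" for e
      unfolding coef_def by (rule tensor_lift_add[OF bal])
    then show ?case
      using add by (simp add: tensor_add_right sum.distrib)
  qed
  have read: "ip2 (e \<otimes> x) w = ip x (coef e w)" if "e \<in> E" for e x w
  proof -
    have "ip2 (e \<otimes> x) w = (\<Sum>f\<in>E. ip e f * ip x (coef f w))"
      by (subst expand[of w]) (simp add: ip2_sum_right ip2_tensor)
    also have "\<dots> = (\<Sum>f\<in>E. (if f = e then ip x (coef f w) else 0))"
      using E that by (intro sum.cong) (auto simp: onb_def)
    finally show ?thesis using E that by (simp add: onb_def)
  qed
  have "coef e u = coef e v" if "e \<in> E" for e
    by (rule ip_nondegenerate) (use assms read[OF that] in metis)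
  then have "(\<Sum>e\<in>E. e \<otimes> coef e u) = (\<Sum>e\<in>E. e \<otimes> coef e v)" by simp
  then show ?thesis unfolding expand[symmetric] .
qed

lemma ip_mult_map:
  assumes "onb E"
  shows "ip (mult_map t) (a * b) = ip2 t (\<Sum>e\<in>E. (a * e) \<otimes> (star e * b))"
proof (induction t rule: tensor_induct)
  case zero
  then show ?case
    by (simp add: mult_map_def tensor_lift_zero balanced_mult ip2_zero_left ip_zero_left)
next
  case (tensor x y)
  have "ip2 (x \<otimes> y) (\<Sum>e\<in>E. (a * e) \<otimes> (star e * b))
      = (\<Sum>e\<in>E. cnj (ip e (star a * x)) * ip (e * y) b)"
    by (simp add: ip2_sum_right ip2_tensor ip_cnj ip_mult_left star_star)
  also have "\<dots> = ip ((\<Sum>e\<in>E. ip e (star a * x) *\<^sub>C e) * y) b"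
    by (simp add: sum_distrib_right mult_scaleC_left ip_sum_left ip_scale_left)
  also have "\<dots> = ip (x * y) (a * b)"
    by (simp add: onb_expand[OF assms] mult.assoc ip_mult_left star_star)
  finally show ?case by (simp add: mult_map_def tensor_lift_tensor balanced_mult)
next
  case (add u v)
  then show ?case
    by (simp add: mult_map_def tensor_lift_add balanced_mult ip2_add_left)
      (simp add: L2_inner_def star_add distrib_right state_add)
qed

text \<open>The freedom to move \<open>a\<close> across the tensor sign is what later puts \<open>x\<^sup>*\<close> and \<open>y\<close> on different
  sides in \<open>A (x\<^sup>* y)\<close>. Both sides represent the functional \<open>t \<mapsto> \<langle>m t, a b\<rangle>\<close>.\<close>

lemma mult_dagger_mult:
  assumes "onb E"
  shows "mult_dagger \<psi> (a * b) = (\<Sum>e\<in>E. (a * e) \<otimes> (star e * b))"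
proof -
  have "mult_dagger \<psi> = (\<lambda>y. \<Sum>e\<in>E. (1 * e) \<otimes> (star e * y))"
    unfolding mult_dagger_def
    by (rule dagger_eqI) (use ip_mult_map[OF assms, of _ 1] ip2_nondegenerate in auto)
  then have "ip2 t (mult_dagger \<psi> (a * b)) = ip (mult_map t) (a * b)" for t
    using ip_mult_map[OF assms, of t 1 "a * b"] by simp
  then show ?thesis
    using ip_mult_map[OF assms] by (intro ip2_nondegenerate) simp
qed

end

section \<open>Positivity of real quantum graphs\<close>

locale real_quantum_graph = quantum_graph +
  assumes real: "real_map A"
begin

lemmas A_scale = complex_vector_pair.linear_scale[OF linear]

lemma A_star: "A (star x) = star (A x)"
  using real unfolding real_map_def star_map_def by (metis star_star)

text \<open>Schur idempotence expresses \<open>A\<close> through products \<open>A (x\<^sup>* e) A (e\<^sup>* y)\<close>, and reality turns the first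
  factor into the adjoint \<open>A (e\<^sup>* x)\<^sup>*\<close>.\<close>

lemma adjacency_gram:
  assumes "onb E"
  shows "A (star x * y) =
    complex_of_real (1 / \<delta>\<^sup>2) *\<^sub>C (\<Sum>e\<in>E. star (A (star e * x)) * A (star e * y))"
proof -
  have "A (star x * y) = schur_product \<psi> \<delta> A A (star x * y)"
    by (simp add: schur_idempotent)
  also have "\<dots> = complex_of_real (1 / \<delta>\<^sup>2) *\<^sub>C (\<Sum>e\<in>E. A (star x * e) * A (star e * y))"
    by (simp add: schur_product_def mult_dagger_mult[OF assms] tensor_map_def mult_map_def
        tensor_lift_sum balanced_mult balanced_tensor_map linear tensor_lift_tensor)
  also have "\<dots> = complex_of_real (1 / \<delta>\<^sup>2) *\<^sub>C (\<Sum>e\<in>E. star (A (star e * x)) * A (star e * y))"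
    by (simp add: star_mult star_star flip: A_star)
  finally show ?thesis .
qed

text \<open>This is \<open>\<psi>\<close> applied to \<open>\<delta>\<^sup>-\<^sup>2 (\<Sum>e\<in>E. w\<^sub>e\<^sup>* w\<^sub>e)\<close> with \<open>w\<^sub>e = A (e\<^sup>* x) - A (e\<^sup>*) c\<close>: a Schwarz
  inequality for the \<open>B\<close>-valued form \<open>(x, y) \<mapsto> A (x\<^sup>* y)\<close> in which the coefficient \<open>c\<close>, still to be
  optimized, is an element of \<open>B\<close>.\<close>

lemma schwarz_positivity:
  "0 \<le> Re (\<psi> (A (star x * x) - star (A x) * c - star c * A x + star c * A 1 * c))"
proof -
  obtain E where E: "onb E" using onb_exists by blast
  define k where "k = 1 / \<delta>\<^sup>2"
  let ?k = "complex_of_real k"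
  define w where "w e = A (star e * x) - A (star e) * c" for e
  have g: "A (star x * x) = ?k *\<^sub>C (\<Sum>e\<in>E. star (A (star e * x)) * A (star e * x))"
      "star (A x) = ?k *\<^sub>C (\<Sum>e\<in>E. star (A (star e * x)) * A (star e))"
      "A x = ?k *\<^sub>C (\<Sum>e\<in>E. star (A (star e)) * A (star e * x))"
      "A 1 = ?k *\<^sub>C (\<Sum>e\<in>E. star (A (star e)) * A (star e))"
    using adjacency_gram[OF E, of x x] adjacency_gram[OF E, of x 1]
      adjacency_gram[OF E, of 1 x] adjacency_gram[OF E, of 1 1]
    by (simp_all add: star_one A_star flip: k_def)
  have "?k *\<^sub>C (\<Sum>e\<in>E. star (w e) * w e)
      = ?k *\<^sub>C (\<Sum>e\<in>E. star (A (star e * x)) * A (star e * x))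
      - (?k *\<^sub>C (\<Sum>e\<in>E. star (A (star e * x)) * A (star e))) * c
      - star c * (?k *\<^sub>C (\<Sum>e\<in>E. star (A (star e)) * A (star e * x)))
      + star c * (?k *\<^sub>C (\<Sum>e\<in>E. star (A (star e)) * A (star e))) * c"
    unfolding w_def star_minus star_mult left_diff_distrib right_diff_distrib
    by (simp add: mult_scaleC_left mult_scaleC_right sum_distrib_left sum_distrib_right
        sum_subtractf complex_vector.scale_right_diff_distrib mult.assoc)
  also have "\<dots> = A (star x * x) - star (A x) * c - star c * A x + star c * A 1 * c"
    unfolding g[symmetric] ..
  finally have "\<psi> (A (star x * x) - star (A x) * c - star c * A x + star c * A 1 * c)
      = \<psi> (?k *\<^sub>C (\<Sum>e\<in>E. star (w e) * w e))"
    by (rule arg_cong[OF HOL.sym])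
  also have "\<dots> = ?k * (\<Sum>e\<in>E. ip (w e) (w e))"
    by (simp add: state_scale state_sum L2_inner_def)
  finally have "Re (\<psi> (A (star x * x) - star (A x) * c - star c * A x + star c * A 1 * c))
      = k * (\<Sum>e\<in>E. Re (ip (w e) (w e)))"
    by simp
  also have "\<dots> \<ge> 0"
    unfolding k_def by (intro mult_nonneg_nonneg sum_nonneg ip_self_nonneg) simp
  finally show ?thesis .
qed

section \<open>The bound on the spectrum of a regular graph\<close>

context
  fixes d :: complex
  assumes regular: "regular \<psi> A d"
begin

lemma A_one: "A 1 = d *\<^sub>C 1"
  using regular by (simp add: regular_def)

text \<open>The condition \<open>A\<^sup>\<dagger> 1 = d 1\<close> read through the inner product.\<close>

lemma state_A: "\<psi> (A x) = d * \<psi> x"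
proof -
  have "ip (A (star x)) 1 = ip (star x) (d *\<^sub>C 1)"
    using ip_dagger[OF linear, of "star x" 1] regular by (simp add: regular_def)
  then show ?thesis
    by (simp add: L2_inner_def A_star star_star mult_scaleC_right state_scale)
qed

lemma degree_real_nonneg: "Im d = 0" "0 \<le> Re d"
proof -
  have one: "\<psi> 1 = 1" using state by (simp add: state_def)
  have "cnj (\<psi> (A 1)) = \<psi> (A 1)"
    by (metis A_star star_one state_star)
  then show "Im d = 0" by (simp add: state_A one complex_eq_iff)
  show "0 \<le> Re d"
    using schwarz_positivity[of 1 0] by (simp add: star_zero star_one state_A one)
qed

text \<open>For \<open>d > 0\<close> the best \<open>c\<close> in the Schwarz inequality is \<open>A x / d\<close>. Taking \<open>c = t A x\<close> with \<open>t\<close> real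
  gives a quadratic polynomial in \<open>t\<close> and also covers \<open>d = 0\<close>.\<close>

lemma L2_bound: "Re (ip (A x) (A x)) \<le> (Re d)\<^sup>2 * Re (ip x x)"
proof -
  let ?r = "Re d" and ?m = "Re (ip (A x) (A x))" and ?n = "Re (ip x x)"
  have *: "0 \<le> ?r * ?n - 2 * t * ?m + t\<^sup>2 * ?r * ?m" for t :: real
  proof -
    define c where "c = complex_of_real t *\<^sub>C A x"
    have "star (A x) * c = complex_of_real t *\<^sub>C (star (A x) * A x)"
        "star c * A x = complex_of_real t *\<^sub>C (star (A x) * A x)"
        "star c * A 1 * c = ((complex_of_real t)\<^sup>2 * d) *\<^sub>C (star (A x) * A x)"
      by (simp_all add: c_def A_one star_scaleC mult_scaleC_left mult_scaleC_right scaleC_scaleC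
          power2_eq_square ac_simps)
    then have "\<psi> (A (star x * x) - star (A x) * c - star c * A x + star c * A 1 * c)
      = d * ip x x - 2 * complex_of_real t * ip (A x) (A x)
        + (complex_of_real t)\<^sup>2 * d * ip (A x) (A x)"
      by (simp add: state_add state_diff state_A state_scale L2_inner_def)
    also have "Re \<dots> = ?r * ?n - 2 * t * ?m + t\<^sup>2 * ?r * ?m"
      by (simp add: power2_eq_square degree_real_nonneg(1) ip_self_Im)
    finally show ?thesis using schwarz_positivity[of x c] by simp
  qed
  show ?thesis
  proof (cases "?r = 0")
    case True
    \<comment> \<open>The polynomial is then \<open>-2 t \<parallel>A x\<parallel>\<^sup>2\<close>, so nonnegativity forces \<open>A x = 0\<close>.\<close>
    then show ?thesis using *[of 1] by simp
  next
    case False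
    then have r: "0 < ?r" using degree_real_nonneg(2) by simp
    \<comment> \<open>The value of \<open>t\<close> that minimizes the quadratic polynomial.\<close>
    have "0 \<le> ?r * (?r * ?n - 2 * (1 / ?r) * ?m + (1 / ?r)\<^sup>2 * ?r * ?m)"
      using *[of "1 / ?r"] r by (intro mult_nonneg_nonneg) simp_all
    also have "\<dots> = ?r\<^sup>2 * ?n - ?m"
      using r by (simp add: field_simps power2_eq_square)
    finally show ?thesis by simp
  qed
qed

text \<open>In finite dimension bijectivity is injectivity, so a \<open>z\<close> outside the disc of radius \<open>d\<close> is excluded
  as soon as it is not an eigenvalue.\<close>

lemma spectrum_bound:
  assumes "z \<in> op_spectrum A"
  shows "cmod z \<le> Re d"
proof (rule ccontr)
  assume "\<not> cmod z \<le> Re d"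
  then have less: "(Re d)\<^sup>2 < (cmod z)\<^sup>2"
    using degree_real_nonneg(2) by (intro power_strict_mono) auto
  let ?T = "\<lambda>x. A x - z *\<^sub>C x"
  have lin: "clinear ?T"
    by (intro complex_vector_pair.linear_compose_sub linear complex_vector.linear_scale_self)
  have "inj ?T"
    unfolding complex_vector_pair.linear_inj_iff_eq_0[OF lin]
  proof (intro allI impI)
    fix x assume "?T x = 0"
    then have Ax: "A x = z *\<^sub>C x" by simp
    have "ip (A x) (A x) = complex_of_real ((cmod z)\<^sup>2) * ip x x"
      by (simp only: Ax ip_scale_left ip_scale_right complex_norm_square) simp
    then have "(cmod z)\<^sup>2 * Re (ip x x) \<le> (Re d)\<^sup>2 * Re (ip x x)"
      using L2_bound[of x] by simp
    then show "x = 0"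
      using less ip_self_pos[of x] by (meson mult_le_cancel_right_pos not_le)
  qed
  moreover have "surj ?T"
  proof -
    obtain S where S: "finite S" "complex_vector.span S = (UNIV::'a set)"
      using finite_dimensional by blast
    obtain B where B: "B \<subseteq> S" "complex_vector.independent B" "S \<subseteq> complex_vector.span B"
      using complex_vector.maximal_independent_subset by blast
    have "complex_vector.span B = UNIV"
      using B(3) S(2) complex_vector.span_mono complex_vector.span_span by (metis top.extremum_uniqueI)
    then interpret fd: finite_dimensional_vector_space "scaleC :: complex \<Rightarrow> 'a \<Rightarrow> 'a" B
      using B S(1) by unfold_locales (auto intro: finite_subset)
    show ?thesis using fd.linear_inj_imp_surj[OF lin \<open>inj ?T\<close>] .
  qed
  ultimately show False using assms by (simp add: op_spectrum_def bij_def)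
qed

lemma degree_in_spectrum: "d \<in> op_spectrum A"
proof -
  have "A 0 = 0" using A_scale[of 0 0] by simp
  then have "(\<lambda>x. A x - d *\<^sub>C x) 1 = (\<lambda>x. A x - d *\<^sub>C x) 0" by (simp add: A_one)
  then have "\<not> inj (\<lambda>x. A x - d *\<^sub>C x)" using zero_neq_one by (metis injD)
  then show ?thesis by (simp add: op_spectrum_def bij_def)
qed

lemma spectral_radius_eq_degree: "complex_of_real (op_spectral_radius A) = d"
proof -
  have "cmod d = Re d" using degree_real_nonneg by (simp add: cmod_def)
  then have "op_spectral_radius A = Re d"
    unfolding op_spectral_radius_def
    using degree_in_spectrum spectrum_bound by (intro cSup_eq_maximum) force+
  then show ?thesis using degree_real_nonneg(1) by (simp add: complex_eq_iff)
qed

end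

end

theorem proposition2p10:
  fixes \<psi> :: "'b::unital_cstar_algebra \<Rightarrow> complex" and \<delta> :: real
    and A :: "'b \<Rightarrow> 'b" and d :: complex
  assumes "quantum_graph \<psi> \<delta> A"
    and "real_map A"
    and "regular \<psi> A d"
  shows "complex_of_real (op_spectral_radius A) = d"
proof -
  interpret real_quantum_graph \<psi> \<delta> A
    using assms by (simp add: real_quantum_graph_def real_quantum_graph_axioms_def)
  show ?thesis by (rule spectral_radius_eq_degree[OF assms(3)])
qed

end
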